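(* Let $X$ be a locally path connected space that is SSLT at $x_0\in X$. Then $X$ is a semilocally small generated space if and only if $\pi_1^{s}(X,x_0)$ is an open subgroup of $\pi_1^{qtop}(X,x_0)$.
   Context: Let $I=[0,1]$; $P(X,x_0)$ denotes the set of paths $\alpha:I\to X$ with $\alpha(0)=x_0$; $\ast$ denotes concatenation and $\alpha^{-1}$ the reversed path. $\pi_1^{qtop}(X,x_0)$ is the fundamental group with the quotient topology from the space $\Omega(X,x_0)$ of loops based at $x_0$ with the compact-open topology, via $\alpha\mapsto[\alpha]$. A loop $\alpha$ in $X$ based at $x$ is small if for every open neighborhood $U$ of $x$ the class $[\alpha]\in\pi_1(X,x)$ has a representative lying in $U$. $\pi_1^{s}(X,x)$ is the subgroup of $\pi_1(X,x)$ consisting of the homotopy classes of all small loops based at $x$. $\pi_1^{sg}(X,x)$ is the subgroup of $\pi_1(X,x)$ generated by the set $\{[\alpha\ast\beta\ast\alpha^{-1}] \mid [\beta]\in\pi_1^{s}(X,\alpha(1)),\ \alpha\in P(X,x)\}$. The space $X$ is SSLT (small "small loop" transfer) at $x_0$ if for every path $\alpha$ in $X$ starting at $x_0$ and every open neighborhood $U$ of $x_0=\alpha(0)$ there is an open neighborhood $V$ of $x_1=\alpha(1)$ such that for every small loop $\beta:I\to V$ based at $x_1$ (small as a loop in $X$) there is a loop $\gamma$ in $U$ based at $x_0$ that is homotopic in $X$ to $\alpha\ast\beta\ast\alpha^{-1}$ relative to $\{0,1\}$. The space $X$ is semilocally small generated if for every $x\in X$ there is an open neighborhood $U$ of $x$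 such that $i_*\pi_1(U,x)\leq\pi_1^{sg}(X,x)$, where $i:U\to X$ is the inclusion.
   Formalization: X is additionally assumed path connected; without this the claim fails, e.g. for the disjoint union of a point x_0 and the Hawaiian earring, where the small loop group at x_0 is open but X is not semilocally small generated. *)

theory Defs
  imports "HOL-Analysis.Analysis" "HOL-Algebra.Generated_Groups"
begin

text \<open>A space is a set \<open>X\<close> of points of a type of class \<^class>\<open>topological_space\<close>,
  with the subspace topology \<open>top_of_set X\<close>; as \<open>X\<close> may be the whole type, every topological
  space is covered. Paths, concatenation, reversal and homotopy relative to the endpoints are
  those of HOL-Analysis: a path is a function \<open>real \<Rightarrow> 'a\<close> of which only the restriction to the
  unit interval matters.\<close>

definition loops_at :: "'a::topological_space set \<Rightarrow> 'a \<Rightarrow> (real \<Rightarrow> 'a) set" where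
  "loops_at X x = {p. path p \<and> path_image p \<subseteq> X \<and> pathstart p = x \<and> pathfinish p = x}"

definition paths_from :: "'a::topological_space set \<Rightarrow> 'a \<Rightarrow> (real \<Rightarrow> 'a) set" where
  "paths_from X x = {p. path p \<and> path_image p \<subseteq> X \<and> pathstart p = x}"

definition open_nbhd :: "'a::topological_space set \<Rightarrow> 'a \<Rightarrow> 'a set \<Rightarrow> bool" where
  "open_nbhd X x U \<longleftrightarrow> openin (top_of_set X) U \<and> x \<in> U"


subsection \<open>The fundamental group\<close>

definition path_class :: "'a::topological_space set \<Rightarrow> (real \<Rightarrow> 'a) \<Rightarrow> (real \<Rightarrow> 'a) set" where
  "path_class X p = {q. homotopic_paths X p q}"

text \<open>The unions below range over representatives; every member is the same homotopy class.\<close>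

definition fundamental_group ::
    "'a::topological_space set \<Rightarrow> 'a \<Rightarrow> (real \<Rightarrow> 'a) set monoid" where
  "fundamental_group X x =
     \<lparr>carrier = path_class X ` loops_at X x,
      mult = (\<lambda>A B. \<Union>p\<in>A. \<Union>q\<in>B. path_class X (p +++ q)),
      one = path_class X (\<lambda>_. x)\<rparr>"

definition induced_map ::
    "'b::topological_space set \<Rightarrow> ('a \<Rightarrow> 'b) \<Rightarrow> (real \<Rightarrow> 'a::topological_space) set \<Rightarrow> (real \<Rightarrow> 'b) set"
  where "induced_map Y f A = (\<Union>p\<in>A. path_class Y (f \<circ> p))"

lemma path_class_eq_iff:
  assumes "path p" "path_image p \<subseteq> X"
  shows "path_class X p = path_class X q \<longleftrightarrow> homotopic_paths X p q"
proof
  assume "path_class X p = path_class X q"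
  moreover have "p \<in> path_class X p"
    using assms by (simp add: path_class_def)
  ultimately show "homotopic_paths X p q"
    by (simp add: path_class_def homotopic_paths_sym)
next
  assume "homotopic_paths X p q"
  then show "path_class X p = path_class X q"
    unfolding path_class_def by (blast intro: homotopic_paths_trans homotopic_paths_sym)
qed

lemma fundamental_group_mult:
  assumes "p \<in> loops_at X x" "q \<in> loops_at X x"
  shows "path_class X p \<otimes>\<^bsub>fundamental_group X x\<^esub> path_class X q = path_class X (p +++ q)"
proof -
  have "path_class X (p' +++ q') = path_class X (p +++ q)"
    if "p' \<in> path_class X p" "q' \<in> path_class X q" for p' q'
  proof -
    have "homotopic_paths X (p +++ q) (p' +++ q')"
      using that assms by (intro homotopic_paths_join) (auto simp: path_class_def loops_at_def)
    then show ?thesis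
      using path_class_eq_iff homotopic_paths_imp_path homotopic_paths_imp_subset by metis
  qed
  moreover have "p \<in> path_class X p" "q \<in> path_class X q"
    using assms by (auto simp: path_class_def loops_at_def)
  ultimately show ?thesis
    unfolding fundamental_group_def monoid.simps by blast
qed

lemma induced_map_path_class:
  assumes "continuous_on X f" "f \<in> X \<rightarrow> Y" "p \<in> loops_at X x"
  shows "induced_map Y f (path_class X p) = path_class Y (f \<circ> p)"
proof -
  have "path_class Y (f \<circ> p') = path_class Y (f \<circ> p)" if "p' \<in> path_class X p" for p'
  proof -
    have "homotopic_paths Y (f \<circ> p) (f \<circ> p')"
      using that assms(1,2) by (auto simp: path_class_def intro: homotopic_paths_continuous_image)
    then show ?thesis
      using path_class_eq_iff homotopic_paths_imp_path homotopic_paths_imp_subset by metis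
  qed
  moreover have "p \<in> path_class X p"
    using assms(3) by (simp add: path_class_def loops_at_def)
  ultimately show ?thesis
    unfolding induced_map_def by blast
qed


subsection \<open>The quotient topology on the fundamental group\<close>

definition compact_open_topology :: "'a topology \<Rightarrow> 'b topology \<Rightarrow> ('a \<Rightarrow> 'b) topology" where
  "compact_open_topology X Y =
     topology_generated_by
       {{f \<in> extensional (topspace X). continuous_map X Y f \<and> f ` K \<subseteq> U} |K U.
          compactin X K \<and> openin Y U}"

definition quotient_topology :: "'a topology \<Rightarrow> ('a \<Rightarrow> 'b) \<Rightarrow> 'b topology" where
  "quotient_topology X f =
     topology (\<lambda>V. V \<subseteq> f ` topspace X \<and> openin X {x \<in> topspace X. f x \<in> V})"

lemma topspace_compact_open_topology:
  "topspace (compact_open_topology X Y) = {f \<in> extensional (topspace X). continuous_map X Y f}"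
  (is "_ = ?C")
proof -
  have "?C = {f \<in> extensional (topspace X). continuous_map X Y f \<and> f ` {} \<subseteq> {}}"
    by simp
  then show ?thesis
    unfolding compact_open_topology_def topology_generated_by_topspace
    using compactin_empty[of X] openin_empty[of Y] by blast
qed

lemma openin_quotient_topology:
  "openin (quotient_topology X f) V \<longleftrightarrow>
     V \<subseteq> f ` topspace X \<and> openin X {x \<in> topspace X. f x \<in> V}"
proof -
  have "istopology (\<lambda>V. V \<subseteq> f ` topspace X \<and> openin X {x \<in> topspace X. f x \<in> V})"
    unfolding istopology_def
  proof (intro conjI allI impI; (elim conjE)?)
    fix S T
    assume "S \<subseteq> f ` topspace X" and S: "openin X {x \<in> topspace X. f x \<in> S}"
      and T: "openin X {x \<in> topspace X. f x \<in> T}"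
    then show "S \<inter> T \<subseteq> f ` topspace X" by blast
    have "{x \<in> topspace X. f x \<in> S} \<inter> {x \<in> topspace X. f x \<in> T} = {x \<in> topspace X. f x \<in> S \<inter> T}"
      by blast
    then show "openin X {x \<in> topspace X. f x \<in> S \<inter> T}"
      using openin_Int[OF S T] by simp
  next
    fix \<K>
    assume *: "\<forall>K\<in>\<K>. K \<subseteq> f ` topspace X \<and> openin X {x \<in> topspace X. f x \<in> K}"
    then show "\<Union>\<K> \<subseteq> f ` topspace X" by blast
    have "openin X (\<Union>K\<in>\<K>. {x \<in> topspace X. f x \<in> K})"
      using * by blast
    moreover have "(\<Union>K\<in>\<K>. {x \<in> topspace X. f x \<in> K}) = {x \<in> topspace X. f x \<in> \<Union>\<K>}"
      by blast
    ultimately show "openin X {x \<in> topspace X. f x \<in> \<Union>\<K>}" by simp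
  qed
  then show ?thesis
    unfolding quotient_topology_def by (simp add: topology_inverse')
qed

lemma quotient_map_quotient_topology: "quotient_map X (quotient_topology X f) f"
proof -
  have "{x \<in> topspace X. f x \<in> f ` topspace X} = topspace X"
    by blast
  then have "openin (quotient_topology X f) (f ` topspace X)"
    by (simp add: openin_quotient_topology)
  then have "topspace (quotient_topology X f) = f ` topspace X"
    by (meson openin_quotient_topology openin_subset openin_topspace subset_antisym)
  then show ?thesis
    unfolding quotient_map_def by (simp add: openin_quotient_topology)
qed

text \<open>In the loop space a loop is a genuine function on the unit interval, rendered as a function
  that is \<^const>\<open>undefined\<close> outside it.\<close>

definition loop_space :: "'a::topological_space set \<Rightarrow> 'a \<Rightarrow> (real \<Rightarrow> 'a) topology" where
  "loop_space X x =
     subtopology (compact_open_topology (top_of_set {0..1}) (top_of_set X))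
       {p. pathstart p = x \<and> pathfinish p = x}"

definition pi1_qtop :: "'a::topological_space set \<Rightarrow> 'a \<Rightarrow> (real \<Rightarrow> 'a) set topology" where
  "pi1_qtop X x = quotient_topology (loop_space X x) (path_class X)"

lemma topspace_loop_space: "topspace (loop_space X x) = loops_at X x \<inter> extensional {0..1}"
  by (auto simp: loop_space_def topspace_compact_open_topology loops_at_def path_def path_image_def)

lemma topspace_pi1_qtop: "topspace (pi1_qtop X x) = carrier (fundamental_group X x)"
proof -
  have "topspace (pi1_qtop X x) = path_class X ` (loops_at X x \<inter> extensional {0..1})"
    using quotient_imp_surjective_map[OF quotient_map_quotient_topology]
    by (metis pi1_qtop_def topspace_loop_space)
  also have "\<dots> = path_class X ` loops_at X x"
  proof -
    have "path_class X p \<in> path_class X ` (loops_at X x \<inter> extensional {0..1})"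
      if p: "p \<in> loops_at X x" for p
    proof -
      have "homotopic_paths X p (restrict p {0..1})"
        using p by (intro homotopic_paths_eq) (auto simp: loops_at_def)
      then have "path_class X p = path_class X (restrict p {0..1})"
        using p by (simp add: path_class_eq_iff loops_at_def)
      moreover have "restrict p {0..1} \<in> loops_at X x"
        using p homotopic_paths_imp_path[OF \<open>homotopic_paths X p _\<close>]
          homotopic_paths_imp_subset[OF \<open>homotopic_paths X p _\<close>]
        by (simp add: loops_at_def pathstart_def pathfinish_def)
      moreover have "restrict p {0..1} \<in> extensional {0..1}"
        by simp
      ultimately show ?thesis by blast
    qed
    then show ?thesis by blast
  qed
  finally show ?thesis by (simp add: fundamental_group_def)
qed


subsection \<open>Small loops\<close>

definition small_loop :: "'a::topological_space set \<Rightarrow> 'a \<Rightarrow> (real \<Rightarrow> 'a) \<Rightarrow> bool" where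
  "small_loop X x p \<longleftrightarrow>
     p \<in> loops_at X x \<and> (\<forall>U. open_nbhd X x U \<longrightarrow> (\<exists>q \<in> path_class X p. path_image q \<subseteq> U))"

definition pi1_small :: "'a::topological_space set \<Rightarrow> 'a \<Rightarrow> (real \<Rightarrow> 'a) set set" where
  "pi1_small X x = {path_class X p |p. small_loop X x p}"

definition pi1_small_generated :: "'a::topological_space set \<Rightarrow> 'a \<Rightarrow> (real \<Rightarrow> 'a) set set" where
  "pi1_small_generated X x =
     generate (fundamental_group X x)
       {path_class X (\<alpha> +++ \<beta> +++ reversepath \<alpha>) |\<alpha> \<beta>.
          \<alpha> \<in> paths_from X x \<and> \<beta> \<in> loops_at X (pathfinish \<alpha>) \<and>
          path_class X \<beta> \<in> pi1_small X (pathfinish \<alpha>)}"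

definition SSLT_at :: "'a::topological_space set \<Rightarrow> 'a \<Rightarrow> bool" where
  "SSLT_at X x0 \<longleftrightarrow>
     (\<forall>\<alpha> U. \<alpha> \<in> paths_from X x0 \<and> open_nbhd X x0 U \<longrightarrow>
        (\<exists>V. open_nbhd X (pathfinish \<alpha>) V \<and>
           (\<forall>\<beta>. small_loop X (pathfinish \<alpha>) \<beta> \<and> path_image \<beta> \<subseteq> V \<longrightarrow>
              (\<exists>\<gamma> \<in> loops_at U x0. homotopic_paths X \<gamma> (\<alpha> +++ \<beta> +++ reversepath \<alpha>)))))"

definition semilocally_small_generated :: "'a::topological_space set \<Rightarrow> bool" where
  "semilocally_small_generated X \<longleftrightarrow>
     (\<forall>x\<in>X. \<exists>U. open_nbhd X x U \<and>
        induced_map X id ` carrier (fundamental_group U x) \<subseteq> pi1_small_generated X x)"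

end

(* Fix X and x0. Two paths p, q with the same endpoints are called equivalent if, for every path
   gamma from x0 to their common start, gamma * q is homotopic to s * gamma * p for some small loop
   s at x0. Small loops at x0 form a group, so this is an equivalence relation compatible with
   concatenation; SSLT says that small loops stay small after transport to x0, so every small loop
   anywhere is equivalent to a constant path, and hence so is every loop with class in pi_1^sg.
   If X is semilocally small generated, every point then has a neighbourhood in which any two paths
   with common endpoints are equivalent. Bisecting [0,1] shows that every loop close to a small loop
   p at x0 is equivalent to p followed by a loop near x0, hence to a constant, hence small.
   Conversely, if pi_1^s is open and alpha is a path from x0 to x, then a compact-open neighbourhood
   of alpha * const * alpha^-1 contains alpha * beta * alpha^-1 for all loops beta at x in some
   neighbourhood U of x; so these are small, and beta = alpha^-1 * (small) * alpha lies in
   pi_1^sg. *)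

theory Submission
  imports Defs
begin

subsection \<open>The groupoid of paths\<close>

text \<open>Hom-sets of the path groupoid before passing to homotopy classes. With both endpoints in
  the membership statement, introduction rules can check that concatenations match;
  \<open>paths_from\<close> leaves the end free.\<close>

definition paths_between :: "'a::topological_space set \<Rightarrow> 'a \<Rightarrow> 'a \<Rightarrow> (real \<Rightarrow> 'a) set" where
  "paths_between X x y =
     {p. path p \<and> path_image p \<subseteq> X \<and> pathstart p = x \<and> pathfinish p = y}"

lemma loops_at_eq_paths_between: "loops_at X x = paths_between X x x"
  by (simp add: loops_at_def paths_between_def)

lemma path_const [simp]: "path (\<lambda>_. x)"
  by (simp add: path_def)

lemma path_image_const [simp]: "path_image (\<lambda>_. x) = {x}"
  by (auto simp: path_image_def)

lemma pathstart_const [simp]: "pathstart (\<lambda>_. x) = x"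
  by (simp add: pathstart_def)

lemma pathfinish_const [simp]: "pathfinish (\<lambda>_. x) = x"
  by (simp add: pathfinish_def)

lemma const_join_const: "(\<lambda>_. x) +++ (\<lambda>_. x) = (\<lambda>_. x)"
  by (simp add: joinpaths_def)

lemma reversepath_const: "reversepath (\<lambda>_. x) = (\<lambda>_. x)"
  by (simp add: reversepath_def)

lemma const_in_paths_between: "x \<in> X \<Longrightarrow> (\<lambda>_. x) \<in> paths_between X x x"
  by (simp add: paths_between_def)

lemma join_in_paths_between:
  "\<lbrakk>p \<in> paths_between X x y; q \<in> paths_between X y z\<rbrakk> \<Longrightarrow> p +++ q \<in> paths_between X x z"
  by (auto simp: paths_between_def path_image_join)

lemma reversepath_in_paths_between:
  "p \<in> paths_between X x y \<Longrightarrow> reversepath p \<in> paths_between X y x"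
  by (simp add: paths_between_def)

lemmas paths_between_intros =
  const_in_paths_between join_in_paths_between reversepath_in_paths_between

lemma paths_between_mono: "\<lbrakk>p \<in> paths_between U x y; U \<subseteq> X\<rbrakk> \<Longrightarrow> p \<in> paths_between X x y"
  by (auto simp: paths_between_def)

lemma paths_between_endpoints:
  assumes "p \<in> paths_between X x y"
  shows "x \<in> X" "y \<in> X"
  using assms pathstart_in_path_image[of p] pathfinish_in_path_image[of p]
  by (auto simp: paths_between_def)

lemma paths_between_homotopic:
  assumes "p \<in> paths_between X x y" "homotopic_paths X p q"
  shows "q \<in> paths_between X x y"
  using assms homotopic_paths_imp_path[OF assms(2)] homotopic_paths_imp_subset[OF assms(2)]
    homotopic_paths_imp_pathstart[OF assms(2)] homotopic_paths_imp_pathfinish[OF assms(2)]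
  by (simp add: paths_between_def)

lemma paths_from_iff: "p \<in> paths_from X x \<longleftrightarrow> p \<in> paths_between X x (pathfinish p)"
  by (simp add: paths_from_def paths_between_def)

lemma path_connected_obtains:
  assumes "path_connected X" "x \<in> X" "y \<in> X"
  obtains p where "p \<in> paths_between X x y"
  using assms unfolding path_connected_def paths_between_def by blast

section \<open>Unit, inverse and subdivision laws via the unit interval\<close>

text \<open>The groupoid laws of HOL-Analysis for constant and reversed paths are stated with
  \<^const>\<open>linepath\<close> and hence only for normed spaces. Here they are transported along \<open>p\<close> from
  the real unit interval. For the same reason, \<open>p \<circ> linepath a b\<close> replaces
  \<^const>\<open>subpath\<close>.\<close>

lemma homotopic_paths_compose_real:
  fixes u v :: "real \<Rightarrow> real"
  assumes p: "path p" "path_image p \<subseteq> X"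
    and u: "u \<in> paths_between {0..1} a b" and v: "v \<in> paths_between {0..1} a b"
  shows "homotopic_paths X (p \<circ> u) (p \<circ> v)"
proof -
  \<comment> \<open>The unit interval is convex, so the straight-line homotopy from \<open>u\<close>
    to \<open>v\<close> stays in it and can be composed with \<open>p\<close>.\<close>
  have "closed_segment (u t) (v t) \<subseteq> {0..1}" if "t \<in> {0..1}" for t
  proof (rule closed_segment_subset)
    show "u t \<in> {0..1}" "v t \<in> {0..1}"
      using u v that unfolding paths_between_def path_image_def by blast+
  qed simp
  then have "homotopic_paths {0..1} u v"
    using u v by (intro homotopic_paths_linear) (auto simp: paths_between_def)
  then show ?thesis
    using p by (intro homotopic_paths_continuous_image) (auto simp: path_def path_image_def)
qed

lemma linepath_in_paths_between:
  "\<lbrakk>0 \<le> a; a \<le> 1; 0 \<le> b; b \<le> 1\<rbrakk> \<Longrightarrow> linepath a b \<in> paths_between {0..1::real} a b"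
  using closed_segment_subset[of a "{0..1}" b] by (auto simp: paths_between_def)

lemma comp_linepath_0_1: "p \<circ> linepath 0 (1::real) = p"
  by (simp add: linepath_def fun_eq_iff)

text \<open>The left side is the image under \<open>p\<close> of the path that runs from 0 to 1 and
  then waits at 1; in the interval this path is homotopic to the identity path.\<close>

lemma homotopic_paths_join_const:
  assumes "p \<in> paths_between X x y"
  shows "homotopic_paths X (p +++ (\<lambda>_. y)) p"
proof -
  have "homotopic_paths X (p \<circ> (linepath 0 1 +++ (\<lambda>_. 1))) (p \<circ> linepath 0 1)"
    using assms
    by (intro homotopic_paths_compose_real[where a = 0 and b = 1] paths_between_intros
        linepath_in_paths_between) (auto simp: paths_between_def closed_segment_eq_real_ivl)
  moreover have "(\<lambda>_::real. y) = p \<circ> (\<lambda>_. 1)"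
    using assms by (auto simp: paths_between_def pathfinish_def)
  ultimately show ?thesis
    by (simp add: path_compose_join comp_linepath_0_1)
qed

lemma homotopic_paths_const_join:
  assumes "p \<in> paths_between X x y"
  shows "homotopic_paths X ((\<lambda>_. x) +++ p) p"
proof -
  have "homotopic_paths X (reversepath (reversepath p +++ (\<lambda>_. x))) (reversepath (reversepath p))"
    unfolding homotopic_paths_reversepath
    by (rule homotopic_paths_join_const[OF reversepath_in_paths_between[OF assms]])
  then show ?thesis
    using assms by (simp add: reversepath_joinpaths reversepath_const paths_between_def)
qed

text \<open>The left side is the image under \<open>p\<close> of the path from 0 to 1 and back, a
  loop at 0 that contracts inside the interval.\<close>

lemma homotopic_paths_join_reversepath:
  assumes "p \<in> paths_between X x y"
  shows "homotopic_paths X (p +++ reversepath p) (\<lambda>_. x)"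
proof -
  have "homotopic_paths X (p \<circ> (linepath 0 1 +++ reversepath (linepath 0 1))) (p \<circ> (\<lambda>_. 0))"
    using assms
    by (intro homotopic_paths_compose_real[where a = 0 and b = 0] paths_between_intros
        linepath_in_paths_between) (auto simp: paths_between_def closed_segment_eq_real_ivl)
  moreover have "(\<lambda>_::real. x) = p \<circ> (\<lambda>_. 0)"
    using assms by (auto simp: paths_between_def pathstart_def)
  ultimately show ?thesis
    by (simp add: path_compose_join path_compose_reversepath comp_linepath_0_1
        del: reversepath_linepath)
qed

lemma homotopic_paths_reversepath_join:
  assumes "p \<in> paths_between X x y"
  shows "homotopic_paths X (reversepath p +++ p) (\<lambda>_. y)"
  using homotopic_paths_join_reversepath[OF reversepath_in_paths_between[OF assms]] by simp

text \<open>Both sides are images under \<open>p\<close> of paths from \<open>a\<close> to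
  \<open>c\<close> in the unit interval. This law joins the two halves in the bisection of a
  loop.\<close>

lemma homotopic_paths_join_linepaths:
  assumes "path p" "path_image p \<subseteq> X" "0 \<le> a" "a \<le> b" "b \<le> c" "c \<le> 1"
  shows "homotopic_paths X ((p \<circ> linepath a b) +++ (p \<circ> linepath b c)) (p \<circ> linepath a c)"
proof -
  have "homotopic_paths X (p \<circ> (linepath a b +++ linepath b c)) (p \<circ> linepath a c)"
    using assms
    by (intro homotopic_paths_compose_real[where a = a and b = c]
        join_in_paths_between[where y = b] linepath_in_paths_between) auto
  then show ?thesis
    by (simp add: path_compose_join)
qed

lemma comp_linepath_in_paths_between:
  assumes "path p" "0 \<le> a" "a \<le> b" "b \<le> 1" "p ` {a..b} \<subseteq> U"
  shows "p \<circ> linepath a b \<in> paths_between U (p a) (p b)"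
proof -
  have "path_image (linepath a b) = {a..b}"
    using assms by (simp add: closed_segment_eq_real_ivl)
  moreover have "path (p \<circ> linepath a b)"
    using assms by (intro path_continuous_image)
      (auto simp: path_def closed_segment_eq_real_ivl intro: continuous_on_subset)
  ultimately show ?thesis
    using assms unfolding paths_between_def
    by (auto simp: path_image_compose pathstart_compose pathfinish_compose)
qed

section \<open>Associativity, congruence and cancellation up to homotopy\<close>

lemma homotopic_paths_refl_between: "p \<in> paths_between X x y \<Longrightarrow> homotopic_paths X p p"
  by (simp add: paths_between_def)

lemma homotopic_paths_join_between:
  "\<lbrakk>homotopic_paths X p p'; homotopic_paths X q q'; p \<in> paths_between X x y;
    q \<in> paths_between X y z\<rbrakk> \<Longrightarrow> homotopic_paths X (p +++ q) (p' +++ q')"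
  by (rule homotopic_paths_join) (auto simp: paths_between_def)

lemma homotopic_paths_join_left:
  "\<lbrakk>homotopic_paths X q q'; p \<in> paths_between X x y;
    q \<in> paths_between X y z\<rbrakk> \<Longrightarrow> homotopic_paths X (p +++ q) (p +++ q')"
  by (rule homotopic_paths_join_between[OF homotopic_paths_refl_between])

lemma homotopic_paths_join_right:
  "\<lbrakk>homotopic_paths X p p'; p \<in> paths_between X x y;
    q \<in> paths_between X y z\<rbrakk> \<Longrightarrow> homotopic_paths X (p +++ q) (p' +++ q)"
  by (rule homotopic_paths_join_between[OF _ homotopic_paths_refl_between])

lemma homotopic_paths_assoc_between:
  assumes "p \<in> paths_between X x y" "q \<in> paths_between X y z" "r \<in> paths_between X z w"
  shows "homotopic_paths X ((p +++ q) +++ r) (p +++ (q +++ r))"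
  by (rule homotopic_paths_sym[OF homotopic_paths_assoc])
    (use assms in \<open>auto simp: paths_between_def\<close>)

lemma homotopic_paths_cancel_reversepath_right:
  assumes "p \<in> paths_between X x y" "q \<in> paths_between X y z"
  shows "homotopic_paths X ((p +++ q) +++ reversepath q) p"
proof -
  have "homotopic_paths X ((p +++ q) +++ reversepath q) (p +++ (q +++ reversepath q))"
    using assms by (intro homotopic_paths_assoc_between paths_between_intros)
  also have "homotopic_paths X \<dots> (p +++ (\<lambda>_. y))"
    using assms
    by (intro homotopic_paths_join_left homotopic_paths_join_reversepath paths_between_intros)
  also have "homotopic_paths X \<dots> p"
    using assms by (rule_tac homotopic_paths_join_const)
  finally show ?thesis .
qed

lemma homotopic_paths_cancel_right:
  assumes "p \<in> paths_between X x y" "q \<in> paths_between X z y"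
  shows "homotopic_paths X ((p +++ reversepath q) +++ q) p"
  using homotopic_paths_cancel_reversepath_right
    [OF assms(1) reversepath_in_paths_between[OF assms(2)]] by simp

lemma homotopic_paths_cancel_left:
  assumes "p \<in> paths_between X x y" "q \<in> paths_between X x z"
  shows "homotopic_paths X (p +++ (reversepath p +++ q)) q"
proof -
  have "homotopic_paths X (p +++ (reversepath p +++ q)) ((p +++ reversepath p) +++ q)"
    using assms
    by (intro homotopic_paths_sym[OF homotopic_paths_assoc_between] paths_between_intros)
  also have "homotopic_paths X \<dots> ((\<lambda>_. x) +++ q)"
    using assms
    by (intro homotopic_paths_join_right homotopic_paths_join_reversepath paths_between_intros)
  also have "homotopic_paths X \<dots> q"
    using assms by (rule_tac homotopic_paths_const_join)
  finally show ?thesis .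
qed

lemma homotopic_paths_cancel_reversepath_left:
  assumes "p \<in> paths_between X x y" "q \<in> paths_between X y z"
  shows "homotopic_paths X (reversepath p +++ (p +++ q)) q"
  using homotopic_paths_cancel_left[OF reversepath_in_paths_between[OF assms(1)] assms(2)] by simp

subsection \<open>Small loops\<close>

lemma path_class_eqI: "homotopic_paths X p q \<Longrightarrow> path_class X p = path_class X q"
  by (rule iffD2[OF path_class_eq_iff])
    (auto dest: homotopic_paths_imp_path homotopic_paths_imp_subset)

lemma small_loop_loops_at: "small_loop X x p \<Longrightarrow> p \<in> paths_between X x x"
  by (simp add: small_loop_def loops_at_eq_paths_between)

lemma small_loopE:
  assumes "small_loop X x p" "open_nbhd X x U"
  obtains q where "homotopic_paths X p q" "path_image q \<subseteq> U"
  using assms by (auto simp: small_loop_def path_class_def)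

lemma small_loopI:
  assumes "p \<in> paths_between X x x"
    and "\<And>U. open_nbhd X x U \<Longrightarrow> \<exists>q. homotopic_paths X p q \<and> path_image q \<subseteq> U"
  shows "small_loop X x p"
  using assms by (auto simp: small_loop_def path_class_def loops_at_eq_paths_between)

lemma small_loop_homotopic:
  assumes "small_loop X x p" "homotopic_paths X p q"
  shows "small_loop X x q"
proof (rule small_loopI)
  show "q \<in> paths_between X x x"
    using assms by (blast intro: paths_between_homotopic small_loop_loops_at)
  fix U assume "open_nbhd X x U"
  with assms(1) obtain r where "homotopic_paths X p r" "path_image r \<subseteq> U"
    by (rule small_loopE)
  then show "\<exists>r. homotopic_paths X q r \<and> path_image r \<subseteq> U"
    using homotopic_paths_trans[OF homotopic_paths_sym[OF assms(2)]] by blast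
qed

text \<open>Smallness depends only on the homotopy class, so membership of a class can be tested on
  any representative.\<close>

lemma path_class_in_pi1_small_iff: "path_class X p \<in> pi1_small X x \<longleftrightarrow> small_loop X x p"
proof
  assume "path_class X p \<in> pi1_small X x"
  then obtain q where q: "small_loop X x q" "path_class X p = path_class X q"
    by (auto simp: pi1_small_def)
  have "homotopic_paths X q p"
    using q path_class_eq_iff[of q X p] by (auto simp: small_loop_def loops_at_def)
  then show "small_loop X x p"
    using q(1) small_loop_homotopic by blast
qed (auto simp: pi1_small_def)

lemma small_loop_const: "x \<in> X \<Longrightarrow> small_loop X x (\<lambda>_. x)"
  by (rule small_loopI)
    (auto simp: open_nbhd_def intro!: const_in_paths_between exI[of _ "\<lambda>_. x"])

lemma small_loop_join:
  assumes "small_loop X x p" "small_loop X x q"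
  shows "small_loop X x (p +++ q)"
proof (rule small_loopI)
  show "p +++ q \<in> paths_between X x x"
    using assms by (blast intro: small_loop_loops_at join_in_paths_between)
  fix U assume U: "open_nbhd X x U"
  obtain p' where p': "homotopic_paths X p p'" "path_image p' \<subseteq> U"
    using small_loopE[OF assms(1) U] .
  obtain q' where q': "homotopic_paths X q q'" "path_image q' \<subseteq> U"
    using small_loopE[OF assms(2) U] .
  have "homotopic_paths X (p +++ q) (p' +++ q')"
    using p' q' assms by (blast intro: homotopic_paths_join_between small_loop_loops_at)
  moreover have "path_image (p' +++ q') \<subseteq> U"
    using p' q' by (intro subset_path_image_join)
  ultimately show "\<exists>r. homotopic_paths X (p +++ q) r \<and> path_image r \<subseteq> U" by blast
qed

lemma small_loop_reversepath:
  assumes "small_loop X x p"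
  shows "small_loop X x (reversepath p)"
proof (rule small_loopI)
  show "reversepath p \<in> paths_between X x x"
    using assms by (blast intro: small_loop_loops_at reversepath_in_paths_between)
  fix U assume "open_nbhd X x U"
  with assms obtain p' where "homotopic_paths X p p'" "path_image p' \<subseteq> U"
    by (rule small_loopE)
  then show "\<exists>r. homotopic_paths X (reversepath p) r \<and> path_image r \<subseteq> U"
    by (metis homotopic_paths_reversepath path_image_reversepath)
qed

text \<open>SSLT speaks only of small loops lying in the neighbourhood \<open>V\<close> that it
  provides. Smallness of \<beta> yields a homotopic loop inside \<open>V\<close>, again small, and
  conjugation by \<alpha> respects this homotopy. Since \<open>U\<close> is arbitrary, the conjugate
  is small.\<close>

lemma small_loop_conjugate:
  assumes "SSLT_at X x0" "\<alpha> \<in> paths_between X x0 x" "small_loop X x \<beta>"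
  shows "small_loop X x0 (\<alpha> +++ \<beta> +++ reversepath \<alpha>)"
proof (rule small_loopI)
  note \<beta> = small_loop_loops_at[OF assms(3)]
  show "\<alpha> +++ \<beta> +++ reversepath \<alpha> \<in> paths_between X x0 x0"
    using assms(2) \<beta> by (intro paths_between_intros)
  have \<alpha>: "\<alpha> \<in> paths_from X x0" "pathfinish \<alpha> = x"
    using assms(2) by (auto simp: paths_between_def paths_from_def)
  fix U assume "open_nbhd X x0 U"
  with assms(1) \<alpha> obtain V where V: "open_nbhd X x V"
    and *: "\<And>\<beta>. \<lbrakk>small_loop X x \<beta>; path_image \<beta> \<subseteq> V\<rbrakk> \<Longrightarrow>
      \<exists>\<gamma>\<in>loops_at U x0. homotopic_paths X \<gamma> (\<alpha> +++ \<beta> +++ reversepath \<alpha>)"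
    unfolding SSLT_at_def by metis
  obtain \<beta>' where \<beta>': "homotopic_paths X \<beta> \<beta>'" "path_image \<beta>' \<subseteq> V"
    using small_loopE[OF assms(3) V] .
  obtain \<gamma> where \<gamma>: "\<gamma> \<in> loops_at U x0"
    and "homotopic_paths X \<gamma> (\<alpha> +++ \<beta>' +++ reversepath \<alpha>)"
    using *[OF small_loop_homotopic[OF assms(3) \<beta>'(1)] \<beta>'(2)] by blast
  moreover have "homotopic_paths X (\<alpha> +++ \<beta> +++ reversepath \<alpha>) (\<alpha> +++ \<beta>' +++ reversepath \<alpha>)"
    using assms(2) \<beta> \<beta>'(1)
    by (intro homotopic_paths_join_left homotopic_paths_join_right paths_between_intros)
  ultimately have "homotopic_paths X (\<alpha> +++ \<beta> +++ reversepath \<alpha>) \<gamma>"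
    using homotopic_paths_sym homotopic_paths_trans by blast
  then show "\<exists>r. homotopic_paths X (\<alpha> +++ \<beta> +++ reversepath \<alpha>) r \<and> path_image r \<subseteq> U"
    using \<gamma> by (auto simp: loops_at_def)
qed

section \<open>Group structure on homotopy classes of loops\<close>

lemma group_fundamental_group:
  assumes "x \<in> X"
  shows "group (fundamental_group X x)"
proof -
  let ?G = "fundamental_group X x"
  have carrier: "carrier ?G = path_class X ` paths_between X x x"
    and one: "\<one>\<^bsub>?G\<^esub> = path_class X (\<lambda>_. x)"
    by (simp_all add: fundamental_group_def loops_at_eq_paths_between)
  have mult: "path_class X p \<otimes>\<^bsub>?G\<^esub> path_class X q = path_class X (p +++ q)"
    if "p \<in> paths_between X x x" "q \<in> paths_between X x x" for p q
    using that by (simp add: fundamental_group_mult loops_at_eq_paths_between)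
  have const: "(\<lambda>_. x) \<in> paths_between X x x"
    using assms by (rule const_in_paths_between)
  show ?thesis
  proof (rule groupI)
    fix A B assume "A \<in> carrier ?G" "B \<in> carrier ?G"
    then show "A \<otimes>\<^bsub>?G\<^esub> B \<in> carrier ?G"
      by (auto simp: carrier mult intro!: imageI join_in_paths_between)
  next
    show "\<one>\<^bsub>?G\<^esub> \<in> carrier ?G"
      using const by (simp add: carrier one)
  next
    fix A B C assume "A \<in> carrier ?G" "B \<in> carrier ?G" "C \<in> carrier ?G"
    then obtain p q r where *: "A = path_class X p" "B = path_class X q" "C = path_class X r"
      "p \<in> paths_between X x x" "q \<in> paths_between X x x" "r \<in> paths_between X x x"
      unfolding carrier by blast
    then show "A \<otimes>\<^bsub>?G\<^esub> B \<otimes>\<^bsub>?G\<^esub> C = A \<otimes>\<^bsub>?G\<^esub> (B \<otimes>\<^bsub>?G\<^esub> C)"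
      by (simp add: mult join_in_paths_between[where y = x] path_class_eqI
          homotopic_paths_assoc_between[where x = x and y = x and z = x and w = x])
  next
    fix A assume "A \<in> carrier ?G"
    then obtain p where p: "A = path_class X p" "p \<in> paths_between X x x"
      unfolding carrier by blast
    show "\<one>\<^bsub>?G\<^esub> \<otimes>\<^bsub>?G\<^esub> A = A"
      using p const by (simp add: one mult path_class_eqI homotopic_paths_const_join)
    show "\<exists>B\<in>carrier ?G. B \<otimes>\<^bsub>?G\<^esub> A = \<one>\<^bsub>?G\<^esub>"
      using p by (intro bexI[of _ "path_class X (reversepath p)"])
        (simp_all add: carrier one mult reversepath_in_paths_between
          path_class_eqI[OF homotopic_paths_reversepath_join])
  qed
qed

lemma inv_fundamental_group:
  assumes "p \<in> loops_at X x"
  shows "inv\<^bsub>fundamental_group X x\<^esub> (path_class X p) = path_class X (reversepath p)"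
proof -
  have p: "p \<in> paths_between X x x" and r: "reversepath p \<in> loops_at X x"
    using assms by (simp_all add: loops_at_eq_paths_between reversepath_in_paths_between)
  interpret group "fundamental_group X x"
    using paths_between_endpoints(1)[OF p] by (rule group_fundamental_group)
  have "path_class X (reversepath p +++ p) = path_class X (\<lambda>_. x)"
    using p by (rule path_class_eqI[OF homotopic_paths_reversepath_join])
  then show ?thesis
    using assms r
    by (intro inv_equality) (simp_all add: fundamental_group_mult, simp_all add: fundamental_group_def)
qed

text \<open>Representatives inside a given neighbourhood remain inside it when reversed or
  concatenated. This supplies the subgroup clause of the final equivalence.\<close>

lemma subgroup_pi1_small:
  assumes "x \<in> X"
  shows "subgroup (pi1_small X x) (fundamental_group X x)"
proof -
  interpret group "fundamental_group X x"
    using assms by (rule group_fundamental_group)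
  have loop: "p \<in> loops_at X x" if "small_loop X x p" for p
    using that by (simp add: small_loop_def)
  show ?thesis
  proof (rule subgroupI)
    show "pi1_small X x \<subseteq> carrier (fundamental_group X x)"
      by (auto simp: pi1_small_def fundamental_group_def loop)
    show "pi1_small X x \<noteq> {}"
      using small_loop_const[OF assms] by (auto simp: pi1_small_def)
    fix A B assume "A \<in> pi1_small X x" "B \<in> pi1_small X x"
    then obtain p q where "A = path_class X p" "B = path_class X q"
      "small_loop X x p" "small_loop X x q"
      by (auto simp: pi1_small_def)
    then show "inv\<^bsub>fundamental_group X x\<^esub> A \<in> pi1_small X x"
      and "A \<otimes>\<^bsub>fundamental_group X x\<^esub> B \<in> pi1_small X x"
      by (simp_all add: inv_fundamental_group fundamental_group_mult loop
          path_class_in_pi1_small_iff small_loop_reversepath small_loop_join)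
  qed
qed

subsection \<open>Equivalence of paths modulo small loops\<close>

text \<open>Equality of the endpoints of the lifts of \<open>\<gamma> +++ p\<close> and \<open>\<gamma> +++ q\<close> in the cover
  corresponding to \<open>pi1_small X x0\<close>.\<close>

definition small_equiv ::
    "'a::topological_space set \<Rightarrow> 'a \<Rightarrow> 'a \<Rightarrow> 'a \<Rightarrow> (real \<Rightarrow> 'a) \<Rightarrow> (real \<Rightarrow> 'a) \<Rightarrow> bool" where
  "small_equiv X x0 x y p q \<longleftrightarrow>
     p \<in> paths_between X x y \<and> q \<in> paths_between X x y \<and>
     (\<forall>\<gamma>\<in>paths_between X x0 x. \<exists>s. small_loop X x0 s \<and>
        homotopic_paths X (s +++ (\<gamma> +++ p)) (\<gamma> +++ q))"

lemma small_equiv_paths: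
  assumes "small_equiv X x0 x y p q"
  shows "p \<in> paths_between X x y" "q \<in> paths_between X x y"
  using assms by (auto simp: small_equiv_def)

lemma small_equivE:
  assumes "small_equiv X x0 x y p q" "\<gamma> \<in> paths_between X x0 x"
  obtains s where "small_loop X x0 s" "s \<in> paths_between X x0 x0"
    "homotopic_paths X (s +++ (\<gamma> +++ p)) (\<gamma> +++ q)"
  using assms small_loop_loops_at by (metis small_equiv_def)

text \<open>The constant loop serves as the small loop \<open>s\<close> for every \<gamma>. Through
  this rule the homotopy calculus feeds into chains of equivalences.\<close>

lemma small_equiv_homotopic:
  assumes "p \<in> paths_between X x y" "homotopic_paths X p q"
  shows "small_equiv X x0 x y p q"
  unfolding small_equiv_def
proof (intro conjI ballI)
  show "p \<in> paths_between X x y" "q \<in> paths_between X x y"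
    by (fact assms(1), fact paths_between_homotopic[OF assms])
  fix \<gamma> assume \<gamma>: "\<gamma> \<in> paths_between X x0 x"
  have "homotopic_paths X ((\<lambda>_. x0) +++ (\<gamma> +++ p)) (\<gamma> +++ p)"
    using \<gamma> assms by (intro homotopic_paths_const_join paths_between_intros)
  also have "homotopic_paths X \<dots> (\<gamma> +++ q)"
    using \<gamma> assms by (intro homotopic_paths_join_left)
  finally show "\<exists>s. small_loop X x0 s \<and> homotopic_paths X (s +++ (\<gamma> +++ p)) (\<gamma> +++ q)"
    using small_loop_const[OF paths_between_endpoints(1)[OF \<gamma>]] by blast
qed

lemma small_equiv_sym:
  assumes "small_equiv X x0 x y p q"
  shows "small_equiv X x0 x y q p"
  unfolding small_equiv_def
proof (intro conjI ballI)
  note pq = small_equiv_paths[OF assms]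
  show "q \<in> paths_between X x y" "p \<in> paths_between X x y"
    by (fact pq)+
  fix \<gamma> assume \<gamma>: "\<gamma> \<in> paths_between X x0 x"
  obtain s where s: "small_loop X x0 s" "s \<in> paths_between X x0 x0"
    and hom: "homotopic_paths X (s +++ (\<gamma> +++ p)) (\<gamma> +++ q)"
    using small_equivE[OF assms \<gamma>] .
  have "homotopic_paths X (reversepath s +++ (\<gamma> +++ q)) (reversepath s +++ (s +++ (\<gamma> +++ p)))"
    using \<gamma> pq s hom
    by (intro homotopic_paths_join_left homotopic_paths_sym[OF hom] paths_between_intros)
  also have "homotopic_paths X \<dots> (\<gamma> +++ p)"
    using \<gamma> pq s by (intro homotopic_paths_cancel_reversepath_left paths_between_intros)
  finally show "\<exists>s. small_loop X x0 s \<and> homotopic_paths X (s +++ (\<gamma> +++ q)) (\<gamma> +++ p)"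
    using small_loop_reversepath[OF s(1)] by blast
qed

text \<open>The small loops act on the left: \<open>s\<close> carries \<open>\<gamma> +++ p\<close>
  to \<open>\<gamma> +++ q\<close> and \<open>t\<close> carries that on to
  \<open>\<gamma> +++ r\<close>, so the witness is \<open>t +++ s\<close>.\<close>

lemma small_equiv_trans [trans]:
  assumes "small_equiv X x0 x y p q" "small_equiv X x0 x y q r"
  shows "small_equiv X x0 x y p r"
  unfolding small_equiv_def
proof (intro conjI ballI)
  note pq = small_equiv_paths[OF assms(1)] and r = small_equiv_paths(2)[OF assms(2)]
  show "p \<in> paths_between X x y" "r \<in> paths_between X x y"
    by (fact pq r)+
  fix \<gamma> assume \<gamma>: "\<gamma> \<in> paths_between X x0 x"
  obtain s where s: "small_loop X x0 s" "s \<in> paths_between X x0 x0"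
    and hom: "homotopic_paths X (s +++ (\<gamma> +++ p)) (\<gamma> +++ q)"
    using small_equivE[OF assms(1) \<gamma>] .
  obtain t where t: "small_loop X x0 t" "t \<in> paths_between X x0 x0"
    and hom': "homotopic_paths X (t +++ (\<gamma> +++ q)) (\<gamma> +++ r)"
    using small_equivE[OF assms(2) \<gamma>] .
  have "homotopic_paths X ((t +++ s) +++ (\<gamma> +++ p)) (t +++ (s +++ (\<gamma> +++ p)))"
    using \<gamma> pq s t by (intro homotopic_paths_assoc_between paths_between_intros)
  also have "homotopic_paths X \<dots> (t +++ (\<gamma> +++ q))"
    using \<gamma> pq s t by (intro homotopic_paths_join_left[OF hom] paths_between_intros)
  also note hom'
  finally show "\<exists>s. small_loop X x0 s \<and> homotopic_paths X (s +++ (\<gamma> +++ p)) (\<gamma> +++ r)"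
    using small_loop_join[OF t(1) s(1)] by blast
qed

text \<open>The equivalence of \<open>q\<close> and \<open>r\<close> is applied to the prolonged
  path \<open>\<gamma> +++ p\<close>. Quantifying over all \<gamma> in the definition makes this
  possible.\<close>

lemma small_equiv_join_left:
  assumes "p \<in> paths_between X x y" "small_equiv X x0 y z q r"
  shows "small_equiv X x0 x z (p +++ q) (p +++ r)"
  unfolding small_equiv_def
proof (intro conjI ballI)
  note qr = small_equiv_paths[OF assms(2)]
  show "p +++ q \<in> paths_between X x z" "p +++ r \<in> paths_between X x z"
    using assms(1) qr by (blast intro: join_in_paths_between)+
  fix \<gamma> assume \<gamma>: "\<gamma> \<in> paths_between X x0 x"
  then have \<gamma>p: "\<gamma> +++ p \<in> paths_between X x0 y"
    using assms(1) by (rule join_in_paths_between)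
  obtain s where s: "small_loop X x0 s" "s \<in> paths_between X x0 x0"
    and hom: "homotopic_paths X (s +++ ((\<gamma> +++ p) +++ q)) ((\<gamma> +++ p) +++ r)"
    using small_equivE[OF assms(2) \<gamma>p] .
  have "homotopic_paths X (s +++ (\<gamma> +++ (p +++ q))) (s +++ ((\<gamma> +++ p) +++ q))"
    using \<gamma> s qr assms(1)
    by (intro homotopic_paths_join_left paths_between_intros
        homotopic_paths_sym[OF homotopic_paths_assoc_between])
  also note hom
  also have "homotopic_paths X ((\<gamma> +++ p) +++ r) (\<gamma> +++ (p +++ r))"
    using \<gamma> qr assms(1) by (intro homotopic_paths_assoc_between)
  finally show "\<exists>s. small_loop X x0 s \<and>
      homotopic_paths X (s +++ (\<gamma> +++ (p +++ q))) (\<gamma> +++ (p +++ r))"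
    using s(1) by blast
qed

text \<open>The small loop stands at the far left, so the same \<open>s\<close> works after
  appending \<open>r\<close>.\<close>

lemma small_equiv_join_right:
  assumes "small_equiv X x0 x y p q" "r \<in> paths_between X y z"
  shows "small_equiv X x0 x z (p +++ r) (q +++ r)"
  unfolding small_equiv_def
proof (intro conjI ballI)
  note pq = small_equiv_paths[OF assms(1)]
  show "p +++ r \<in> paths_between X x z" "q +++ r \<in> paths_between X x z"
    using assms(2) pq by (blast intro: join_in_paths_between)+
  fix \<gamma> assume \<gamma>: "\<gamma> \<in> paths_between X x0 x"
  obtain s where s: "small_loop X x0 s" "s \<in> paths_between X x0 x0"
    and hom: "homotopic_paths X (s +++ (\<gamma> +++ p)) (\<gamma> +++ q)"
    using small_equivE[OF assms(1) \<gamma>] .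
  have "homotopic_paths X (s +++ (\<gamma> +++ (p +++ r))) (s +++ ((\<gamma> +++ p) +++ r))"
    using \<gamma> s pq assms(2)
    by (intro homotopic_paths_join_left paths_between_intros
        homotopic_paths_sym[OF homotopic_paths_assoc_between])
  also have "homotopic_paths X \<dots> ((s +++ (\<gamma> +++ p)) +++ r)"
    using \<gamma> s pq assms(2)
    by (intro paths_between_intros homotopic_paths_sym[OF homotopic_paths_assoc_between])
  also have "homotopic_paths X \<dots> ((\<gamma> +++ q) +++ r)"
    using \<gamma> s pq assms(2) by (intro homotopic_paths_join_right[OF hom] paths_between_intros)
  also have "homotopic_paths X \<dots> (\<gamma> +++ (q +++ r))"
    using \<gamma> pq assms(2) by (intro homotopic_paths_assoc_between)
  finally show "\<exists>s. small_loop X x0 s \<and>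
      homotopic_paths X (s +++ (\<gamma> +++ (p +++ r))) (\<gamma> +++ (q +++ r))"
    using s(1) by blast
qed

lemma small_equiv_cancel_left:
  assumes "small_equiv X x0 x z (p +++ q) (p +++ r)"
    and "p \<in> paths_between X x y" "q \<in> paths_between X y z" "r \<in> paths_between X y z"
  shows "small_equiv X x0 y z q r"
proof -
  have "small_equiv X x0 y z q (reversepath p +++ (p +++ q))"
    using assms(2-)
    by (intro small_equiv_sym[OF small_equiv_homotopic] homotopic_paths_cancel_reversepath_left
        paths_between_intros)
  also have "small_equiv X x0 y z \<dots> (reversepath p +++ (p +++ r))"
    using assms(2) by (intro small_equiv_join_left[OF _ assms(1)] paths_between_intros)
  also have "small_equiv X x0 y z \<dots> r"
    using assms(2-)
    by (intro small_equiv_homotopic homotopic_paths_cancel_reversepath_left paths_between_intros)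
  finally show ?thesis .
qed

text \<open>For given \<gamma> the witness is
  \<open>\<gamma> +++ \<beta> +++ reversepath \<gamma>\<close>, which SSLT makes small at
  \<open>x0\<close>; followed by \<gamma> it cancels to \<open>\<gamma> +++ \<beta>\<close>. This is
  where SSLT enters the calculus.\<close>

lemma small_loop_imp_small_equiv_const:
  assumes "SSLT_at X x0" "small_loop X x \<beta>"
  shows "small_equiv X x0 x x (\<lambda>_. x) \<beta>"
  unfolding small_equiv_def
proof (intro conjI ballI)
  show \<beta>: "\<beta> \<in> paths_between X x x"
    using assms(2) by (rule small_loop_loops_at)
  then show c: "(\<lambda>_. x) \<in> paths_between X x x"
    by (intro const_in_paths_between paths_between_endpoints[OF \<beta>])
  fix \<gamma> assume \<gamma>: "\<gamma> \<in> paths_between X x0 x"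
  let ?s = "\<gamma> +++ (\<beta> +++ reversepath \<gamma>)"
  have "homotopic_paths X (?s +++ (\<gamma> +++ (\<lambda>_. x))) (?s +++ \<gamma>)"
    using \<gamma> \<beta> c
    by (intro homotopic_paths_join_left homotopic_paths_join_const paths_between_intros(2,3))
  also have "homotopic_paths X \<dots> (((\<gamma> +++ \<beta>) +++ reversepath \<gamma>) +++ \<gamma>)"
    using \<gamma> \<beta>
    by (intro homotopic_paths_join_right homotopic_paths_sym[OF homotopic_paths_assoc_between]
        paths_between_intros)
  also have "homotopic_paths X \<dots> (\<gamma> +++ \<beta>)"
    using \<gamma> \<beta> by (intro homotopic_paths_cancel_right paths_between_intros)
  finally show "\<exists>s. small_loop X x0 s \<and>
      homotopic_paths X (s +++ (\<gamma> +++ (\<lambda>_. x))) (\<gamma> +++ \<beta>)"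
    using small_loop_conjugate[OF assms(1) \<gamma> assms(2)] by blast
qed

text \<open>Taking the constant path at \<open>x0\<close> for \<gamma> reduces the defining homotopy
  to one between \<open>s\<close> and \<beta>. Every argument by equivalence returns to smallness
  through this rule.\<close>

lemma small_equiv_const_imp_small_loop:
  assumes "small_equiv X x0 x0 x0 (\<lambda>_. x0) \<beta>"
  shows "small_loop X x0 \<beta>"
proof -
  note \<beta> = small_equiv_paths[OF assms]
  obtain s where s: "small_loop X x0 s" "s \<in> paths_between X x0 x0"
    and hom: "homotopic_paths X (s +++ ((\<lambda>_. x0) +++ (\<lambda>_. x0))) ((\<lambda>_. x0) +++ \<beta>)"
    using small_equivE[OF assms \<beta>(1)] .
  have "homotopic_paths X s (s +++ (\<lambda>_. x0))"
    using s(2) by (rule homotopic_paths_sym[OF homotopic_paths_join_const])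
  also have "homotopic_paths X \<dots> ((\<lambda>_. x0) +++ \<beta>)"
    using hom by (simp add: const_join_const)
  also have "homotopic_paths X \<dots> \<beta>"
    using \<beta>(2) by (rule homotopic_paths_const_join)
  finally show ?thesis
    using s(1) small_loop_homotopic by blast
qed

text \<open>Appending \<open>q\<close> to both sides of the loop condition and cancelling gives the
  claim. It turns knowledge about loops into knowledge about pairs of paths.\<close>

lemma small_equiv_if_small_equiv_join_reversepath:
  assumes "p \<in> paths_between X x y" "q \<in> paths_between X x y"
    and "small_equiv X x0 x x (\<lambda>_. x) (p +++ reversepath q)"
  shows "small_equiv X x0 x y p q"
proof -
  have "small_equiv X x0 x y p ((p +++ reversepath q) +++ q)"
    using assms(1,2)
    by (intro small_equiv_homotopic homotopic_paths_sym[OF homotopic_paths_cancel_right])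
  also have "small_equiv X x0 x y \<dots> ((\<lambda>_. x) +++ q)"
    by (rule small_equiv_join_right[OF small_equiv_sym[OF assms(3)] assms(2)])
  also have "small_equiv X x0 x y \<dots> q"
    using assms(2) small_equiv_paths(1)[OF assms(3)]
    by (intro small_equiv_homotopic homotopic_paths_const_join join_in_paths_between)
  finally show ?thesis .
qed

text \<open>The classes of loops equivalent to the constant form a subgroup that contains every
  generator of \<open>pi1_small_generated X x\<close>, hence the whole generated subgroup.\<close>

lemma pi1_small_generated_imp_small_equiv_const:
  assumes "SSLT_at X x0" "x \<in> X"
    and "\<beta> \<in> loops_at X x" "path_class X \<beta> \<in> pi1_small_generated X x"
  shows "small_equiv X x0 x x (\<lambda>_. x) \<beta>"
proof -
  let ?G = "fundamental_group X x"
  let ?c = "\<lambda>_::real. x"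
  interpret group ?G
    using assms(2) by (rule group_fundamental_group)
  define K where "K = {path_class X l |l. small_equiv X x0 x x ?c l}"
  have loop: "l \<in> loops_at X x" if "small_equiv X x0 x x ?c l" for l
    using that small_equiv_paths by (simp add: loops_at_eq_paths_between)
  have c: "?c \<in> paths_between X x x"
    using assms(2) by (rule const_in_paths_between)
  have "subgroup K ?G"
  proof (rule subgroupI)
    show "K \<subseteq> carrier ?G"
      by (auto simp: K_def fundamental_group_def loop)
    show "K \<noteq> {}"
      using small_equiv_homotopic[OF c homotopic_paths_refl_between[OF c]] by (auto simp: K_def)
    fix A B assume "A \<in> K" "B \<in> K"
    then obtain p q where A: "A = path_class X p" and B: "B = path_class X q"
      and p: "small_equiv X x0 x x ?c p" and q: "small_equiv X x0 x x ?c q"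
      by (auto simp: K_def)
    note pq = small_equiv_paths(2)[OF p] small_equiv_paths(2)[OF q]
    \<comment> \<open>Closure under inverses: the equivalence of \<open>p\<close> with the constant
      is multiplied on the left by \<open>reversepath p\<close>.\<close>
    have "small_equiv X x0 x x ?c (reversepath p +++ p)"
      using pq c
      by (intro small_equiv_sym[OF small_equiv_homotopic] homotopic_paths_reversepath_join
          paths_between_intros(2,3))
    also have "small_equiv X x0 x x \<dots> (reversepath p +++ ?c)"
      using pq by (intro small_equiv_join_left[OF _ small_equiv_sym[OF p]] paths_between_intros)
    also have "small_equiv X x0 x x \<dots> (reversepath p)"
      using pq c by (intro small_equiv_homotopic homotopic_paths_join_const
          paths_between_intros(2,3))
    finally show "inv\<^bsub>?G\<^esub> A \<in> K"
      using loop[OF p] unfolding A K_def by (auto simp: inv_fundamental_group)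
    note q
    also have "small_equiv X x0 x x q (?c +++ q)"
      using pq c by (intro small_equiv_sym[OF small_equiv_homotopic] homotopic_paths_const_join
          paths_between_intros(2,3))
    also have "small_equiv X x0 x x \<dots> (p +++ q)"
      using p pq by (intro small_equiv_join_right)
    finally show "A \<otimes>\<^bsub>?G\<^esub> B \<in> K"
      using loop[OF p] loop[OF q] unfolding A B K_def by (auto simp: fundamental_group_mult)
  qed
  moreover have "path_class X (\<alpha> +++ \<beta> +++ reversepath \<alpha>) \<in> K"
    if "\<alpha> \<in> paths_from X x" "path_class X \<beta> \<in> pi1_small X (pathfinish \<alpha>)" for \<alpha> \<beta>
  proof -
    define y where "y = pathfinish \<alpha>"
    have \<alpha>: "\<alpha> \<in> paths_between X x y"
      using that(1) by (simp add: paths_from_iff y_def)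
    have y: "(\<lambda>_. y) \<in> paths_between X y y"
      by (intro const_in_paths_between paths_between_endpoints[OF \<alpha>])
    have small: "small_loop X y \<beta>"
      using that(2) by (simp add: path_class_in_pi1_small_iff y_def)
    \<comment> \<open>Generators lie in \<open>K\<close>: a constant is inserted between \<alpha>
      and its reverse and then exchanged for the small loop \<beta>.\<close>
    have "small_equiv X x0 x x ?c (\<alpha> +++ reversepath \<alpha>)"
      using \<alpha> by (intro small_equiv_sym[OF small_equiv_homotopic]
          homotopic_paths_join_reversepath paths_between_intros(2,3))
    also have "small_equiv X x0 x x \<dots> (\<alpha> +++ ((\<lambda>_. y) +++ reversepath \<alpha>))"
      using \<alpha> y by (intro small_equiv_sym[OF small_equiv_homotopic] homotopic_paths_join_left
          homotopic_paths_const_join paths_between_intros(2,3))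
    also have "small_equiv X x0 x x \<dots> (\<alpha> +++ (\<beta> +++ reversepath \<alpha>))"
      using \<alpha> y small_loop_imp_small_equiv_const[OF assms(1) small]
      by (intro small_equiv_join_left small_equiv_join_right paths_between_intros(2,3))
    finally show ?thesis by (auto simp: K_def)
  qed
  ultimately have "pi1_small_generated X x \<subseteq> K"
    unfolding pi1_small_generated_def by (intro generate_subgroup_incl) auto
  then obtain l where l: "path_class X \<beta> = path_class X l" "small_equiv X x0 x x ?c l"
    using assms(4) by (auto simp: K_def)
  \<comment> \<open>\<open>K\<close> consists of classes, so its membership yields only some
    representative \<open>l\<close>; the equivalence passes from \<open>l\<close> to \<beta> along a
    homotopy.\<close>
  have "homotopic_paths X l \<beta>"
    using l loop[OF l(2)] path_class_eq_iff[of l X \<beta>] by (auto simp: loops_at_def)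
  with l(2) show ?thesis
    by (intro small_equiv_trans[OF l(2)] small_equiv_homotopic small_equiv_paths(2)[OF l(2)])
qed

subsection \<open>The compact-open topology\<close>

lemma open_nbhd_subset: "open_nbhd X x U \<Longrightarrow> U \<subseteq> X"
  by (auto simp: open_nbhd_def dest: openin_imp_subset)

lemma induced_map_inclusion:
  assumes "U \<subseteq> X" "l \<in> loops_at U x"
  shows "induced_map X id (path_class U l) = path_class X l"
proof -
  have "id \<in> U \<rightarrow> X"
    using assms(1) by auto
  then show ?thesis
    using induced_map_path_class[OF continuous_on_id _ assms(2)] by (simp add: id_def comp_def)
qed

text \<open>The set is the trace on the based loops of a subbasic set of the compact-open
  topology.\<close>

lemma openin_loop_space_subbasis:
  assumes "compact K" "K \<subseteq> {0..1}" "openin (top_of_set X) U"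
  shows "openin (loop_space X x) {q \<in> topspace (loop_space X x). q ` K \<subseteq> U}"
proof -
  let ?B = "{f \<in> extensional (topspace (top_of_set {0..1::real})).
    continuous_map (top_of_set {0..1}) (top_of_set X) f \<and> f ` K \<subseteq> U}"
  have "compactin (top_of_set {0..1}) K"
    using assms by (simp add: compactin_subtopology)
  then have "openin (compact_open_topology (top_of_set {0..1}) (top_of_set X)) ?B"
    unfolding compact_open_topology_def using assms(3)
    by (intro topology_generated_by_Basis) blast
  moreover have "{q \<in> topspace (loop_space X x). q ` K \<subseteq> U} =
      ?B \<inter> {p. pathstart p = x \<and> pathfinish p = x}"
    by (auto simp: loop_space_def topspace_compact_open_topology)
  ultimately show ?thesis
    unfolding loop_space_def openin_subtopology by blast
qed

text \<open>The two paths can differ only for parameters in (1/2, 3/4], where one runs through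
  \<beta> inside \<open>U\<close> and the other rests at \<open>x\<close>.\<close>

lemma join_const_cases:
  assumes "\<beta> \<in> loops_at U x" "t \<in> {0..1}"
  shows "(\<alpha> +++ (\<beta> +++ \<gamma>)) t = (\<alpha> +++ ((\<lambda>_. x) +++ \<gamma>)) t \<or>
    (\<alpha> +++ ((\<lambda>_. x) +++ \<gamma>)) t = x \<and> (\<alpha> +++ (\<beta> +++ \<gamma>)) t \<in> U"
  using assms by (auto simp: joinpaths_def loops_at_def path_image_def image_subset_iff)

lemma restrict_in_compact_open_topology:
  assumes "p \<in> paths_between X x y"
  shows "restrict p {0..1} \<in> topspace (compact_open_topology (top_of_set {0..1}) (top_of_set X))"
  using assms continuous_on_cong[of "{0..1::real}" "{0..1}" "restrict p {0..1}" p]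
  by (auto simp: topspace_compact_open_topology paths_between_def path_def path_image_def)

text \<open>A form of continuity, at the constant loop, of inserting \<beta> between \<alpha> and
  \<gamma>. The proof is by induction on how \<open>T\<close> is generated from the
  subbasis.\<close>

lemma compact_open_nbhd_insert_loop:
  assumes \<alpha>: "\<alpha> \<in> paths_between X y x" and \<gamma>: "\<gamma> \<in> paths_between X x z"
    and "openin (compact_open_topology (top_of_set {0..1}) (top_of_set X)) T"
    and "restrict (\<alpha> +++ ((\<lambda>_. x) +++ \<gamma>)) {0..1} \<in> T"
  shows "\<exists>U. open_nbhd X x U \<and> (\<forall>\<beta>\<in>loops_at U x. restrict (\<alpha> +++ (\<beta> +++ \<gamma>)) {0..1} \<in> T)"
  using openin_topology_generated_by[OF assms(3)[unfolded compact_open_topology_def]] assms(4)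
proof (induction rule: generate_topology_on.induct)
  case Empty
  then show ?case by simp
next
  case (Int a b)
  then obtain U V
    where "open_nbhd X x U" "\<forall>\<beta>\<in>loops_at U x. restrict (\<alpha> +++ (\<beta> +++ \<gamma>)) {0..1} \<in> a"
      and "open_nbhd X x V" "\<forall>\<beta>\<in>loops_at V x. restrict (\<alpha> +++ (\<beta> +++ \<gamma>)) {0..1} \<in> b"
    by blast
  moreover have "loops_at (U \<inter> V) x \<subseteq> loops_at U x \<inter> loops_at V x"
    by (auto simp: loops_at_def)
  moreover have "open_nbhd X x (U \<inter> V)"
    using \<open>open_nbhd X x U\<close> \<open>open_nbhd X x V\<close> by (simp add: open_nbhd_def openin_Int)
  ultimately show ?case by blast
next
  case (UN \<K>)
  then obtain k where "k \<in> \<K>" "restrict (\<alpha> +++ ((\<lambda>_. x) +++ \<gamma>)) {0..1} \<in> k" by blast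
  with UN.IH[of k] show ?case by blast
next
  case (Basis S)
  then obtain K W where S: "S = {f \<in> extensional (topspace (top_of_set {0..1::real})).
      continuous_map (top_of_set {0..1}) (top_of_set X) f \<and> f ` K \<subseteq> W}"
    and K: "compactin (top_of_set {0..1}) K" and W: "openin (top_of_set X) W"
    by blast
  have K01: "K \<subseteq> {0..1}"
    using K by (simp add: compactin_subtopology)
  \<comment> \<open>For \<open>t\<close> in \<open>K\<close> the path with the constant inserted has
    its value in \<open>W\<close>. If \<open>x\<close> is not in \<open>W\<close>, it is therefore
    not resting at \<open>x\<close> at time \<open>t\<close>, and inserting \<beta> changes nothing
    there, so all of \<open>X\<close> is allowed. Otherwise \<beta> has to stay in
    \<open>W\<close>.\<close>
  define U where "U = (if x \<in> W then W else X)"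
  have "x \<in> X"
    using \<gamma> by (rule paths_between_endpoints)
  then have U: "open_nbhd X x U"
    using W by (simp add: U_def open_nbhd_def)
  then have "U \<subseteq> X"
    by (rule open_nbhd_subset)
  have "restrict (\<alpha> +++ (\<beta> +++ \<gamma>)) {0..1} \<in> S" if \<beta>: "\<beta> \<in> loops_at U x" for \<beta>
  proof -
    have "\<alpha> +++ (\<beta> +++ \<gamma>) \<in> paths_between X y z"
      using \<alpha> \<gamma> \<beta> \<open>U \<subseteq> X\<close>
      by (intro join_in_paths_between) (auto simp: loops_at_eq_paths_between paths_between_mono)
    then have "restrict (\<alpha> +++ (\<beta> +++ \<gamma>)) {0..1} \<in> topspace
        (compact_open_topology (top_of_set {0..1}) (top_of_set X))"
      by (rule restrict_in_compact_open_topology)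
    moreover have "(\<alpha> +++ (\<beta> +++ \<gamma>)) t \<in> W" if t: "t \<in> K" for t
    proof -
      have t01: "t \<in> {0..1}"
        using t K01 by blast
      have "restrict (\<alpha> +++ ((\<lambda>_. x) +++ \<gamma>)) {0..1} t \<in> W"
        using Basis.prems t unfolding S by blast
      then have "(\<alpha> +++ ((\<lambda>_. x) +++ \<gamma>)) t \<in> W"
        using t01 by simp
      then show ?thesis
        using join_const_cases[OF \<beta> t01, of \<alpha> \<gamma>] by (auto simp: U_def)
    qed
    ultimately show ?thesis
      using K01 unfolding S topspace_compact_open_topology by auto
  qed
  with U show ?case by blast
qed

section \<open>From openness to semilocal small generation\<close>

lemma open_pi1_small_imp_semilocally_small_generated:
  assumes "path_connected X" "x0 \<in> X" "openin (pi1_qtop X x0) (pi1_small X x0)"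
  shows "semilocally_small_generated X"
  unfolding semilocally_small_generated_def
proof
  fix x assume "x \<in> X"
  obtain \<alpha> where \<alpha>: "\<alpha> \<in> paths_between X x0 x"
    using path_connected_obtains[OF assms(1,2) \<open>x \<in> X\<close>] .
  define conj where "conj \<beta> = \<alpha> +++ (\<beta> +++ reversepath \<alpha>)" for \<beta>
  have conj: "conj \<beta> \<in> paths_between X x0 x0" if "\<beta> \<in> paths_between X x x" for \<beta>
    unfolding conj_def using \<alpha> that by (intro paths_between_intros)
  \<comment> \<open>Points of \<open>loop_space\<close> are undefined outside the unit interval, so
    loops are replaced by their restrictions, which are homotopic to them.\<close>
  have restrict: "homotopic_paths X p (restrict p {0..1})" if "p \<in> paths_between X y z" for p y z
    using that by (intro homotopic_paths_eq) (auto simp: paths_between_def)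
  have const: "(\<lambda>_. x) \<in> paths_between X x x"
    using \<open>x \<in> X\<close> by (rule const_in_paths_between)
  have "openin (loop_space X x0)
      {p \<in> topspace (loop_space X x0). path_class X p \<in> pi1_small X x0}"
    using assms(3) by (simp add: pi1_qtop_def openin_quotient_topology)
  then obtain T where T: "openin (compact_open_topology (top_of_set {0..1}) (top_of_set X)) T"
    and T_eq: "{p \<in> topspace (loop_space X x0). path_class X p \<in> pi1_small X x0} =
      T \<inter> {p. pathstart p = x0 \<and> pathfinish p = x0}"
    unfolding loop_space_def openin_subtopology by blast
  \<comment> \<open>The conjugate of the constant is null-homotopic, hence small, hence its
    restriction lies in \<open>T\<close>. This is the point around which openness is
    exploited.\<close>
  have "homotopic_paths X (conj (\<lambda>_. x)) (\<alpha> +++ reversepath \<alpha>)"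
    unfolding conj_def using \<alpha> const
    by (intro homotopic_paths_join_left homotopic_paths_const_join paths_between_intros(2,3))
  also have "homotopic_paths X \<dots> (\<lambda>_. x0)"
    using \<alpha> by (rule homotopic_paths_join_reversepath)
  finally have "homotopic_paths X (\<lambda>_. x0) (restrict (conj (\<lambda>_. x)) {0..1})"
    using restrict[OF conj[OF const]] homotopic_paths_sym homotopic_paths_trans by blast
  then have "small_loop X x0 (restrict (conj (\<lambda>_. x)) {0..1})"
    using small_loop_const[OF assms(2)] small_loop_homotopic by blast
  then have "restrict (conj (\<lambda>_. x)) {0..1} \<in> T"
    using T_eq by (auto simp: topspace_loop_space path_class_in_pi1_small_iff small_loop_def)
  then obtain U where U: "open_nbhd X x U"
    and UT: "\<And>\<beta>. \<beta> \<in> loops_at U x \<Longrightarrow> restrict (conj \<beta>) {0..1} \<in> T"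
    using compact_open_nbhd_insert_loop[OF \<alpha> reversepath_in_paths_between[OF \<alpha>] T]
    unfolding conj_def by blast
  have "U \<subseteq> X"
    using U by (rule open_nbhd_subset)
  have "induced_map X id (path_class U l) \<in> pi1_small_generated X x"
    if l: "l \<in> loops_at U x" for l
  proof -
    have lX: "l \<in> paths_between X x x"
      using l \<open>U \<subseteq> X\<close> by (simp add: loops_at_eq_paths_between paths_between_mono)
    have rst: "restrict (conj l) {0..1} \<in> paths_between X x0 x0"
      using conj[OF lX] restrict[OF conj[OF lX]] by (rule paths_between_homotopic)
    then have "path_class X (restrict (conj l) {0..1}) \<in> pi1_small X x0"
      using UT[OF l] T_eq by (auto simp: paths_between_def)
    then have small: "path_class X (conj l) \<in> pi1_small X x0"
      using path_class_eqI[OF restrict[OF conj[OF lX]]] by simp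
    have "homotopic_paths X (reversepath \<alpha> +++ (conj l +++ \<alpha>)) (reversepath \<alpha> +++ (\<alpha> +++ l))"
    proof (intro homotopic_paths_join_left)
      have "homotopic_paths X (conj l +++ \<alpha>) (((\<alpha> +++ l) +++ reversepath \<alpha>) +++ \<alpha>)"
        unfolding conj_def using \<alpha> lX
        by (intro homotopic_paths_join_right homotopic_paths_sym[OF homotopic_paths_assoc_between]
            paths_between_intros)
      also have "homotopic_paths X \<dots> (\<alpha> +++ l)"
        using \<alpha> lX by (intro homotopic_paths_cancel_right paths_between_intros)
      finally show "homotopic_paths X (conj l +++ \<alpha>) (\<alpha> +++ l)" .
    qed (use \<alpha> conj[OF lX] in \<open>blast intro: paths_between_intros\<close>)+
    also have "homotopic_paths X \<dots> l"
      using \<alpha> lX by (rule homotopic_paths_cancel_reversepath_left)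
    \<comment> \<open>Undoing the conjugation exhibits \<open>l\<close> as a single generator, with
      \<open>reversepath \<alpha>\<close> as the path from \<open>x\<close> to \<open>x0\<close> and
      \<open>conj l\<close> as the small loop. The double reversal is kept to match the shape of the
      generators.\<close>
    finally have "path_class X l =
        path_class X (reversepath \<alpha> +++ (conj l +++ reversepath (reversepath \<alpha>)))"
      by (simp add: path_class_eqI)
    moreover have "reversepath \<alpha> \<in> paths_from X x" "pathfinish (reversepath \<alpha>) = x0"
      using \<alpha> by (auto simp: paths_between_def paths_from_def)
    ultimately have "path_class X l \<in> pi1_small_generated X x"
      using small conj[OF lX] unfolding pi1_small_generated_def loops_at_eq_paths_between
      by (intro generate.incl) blast
    moreover have "induced_map X id (path_class U l) = path_class X l"
      using \<open>U \<subseteq> X\<close> l by (rule induced_map_inclusion)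
    ultimately show ?thesis by simp
  qed
  then show "\<exists>U. open_nbhd X x U \<and>
      induced_map X id ` carrier (fundamental_group U x) \<subseteq> pi1_small_generated X x"
    using U by (auto simp: fundamental_group_def)
qed

subsection \<open>Openness of the group of small loops\<close>

text \<open>Small generation controls only loops at \<open>x\<close>. Two paths \<open>u\<close>,
  \<open>v\<close> from \<open>y\<close> to \<open>z\<close> are tied to \<open>x\<close> by a path
  \<delta> to \<open>y\<close>: the loop
  \<open>(\<delta> +++ u) +++ reversepath (\<delta> +++ v)\<close> is equivalent to the constant,
  and then \<delta> cancels.\<close>

lemma small_equiv_nbhd:
  assumes "SSLT_at X x0" "locally path_connected X" "semilocally_small_generated X" "x \<in> X"
  obtains U where "open_nbhd X x U"
    and "\<And>y z u v. \<lbrakk>u \<in> paths_between U y z; v \<in> paths_between U y z\<rbrakk> \<Longrightarrow>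
      small_equiv X x0 y z u v"
proof -
  obtain U0 where U0: "open_nbhd X x U0"
    and sg: "induced_map X id ` carrier (fundamental_group U0 x) \<subseteq> pi1_small_generated X x"
    using assms(3,4) unfolding semilocally_small_generated_def by blast
  \<comment> \<open>Local path connectedness shrinks \<open>U0\<close> to a path connected
    \<open>U\<close>, so that \<delta> can be found in \<open>U\<close>; the loops formed in
    \<open>U\<close> still lie in \<open>U0\<close>.\<close>
  obtain U where U: "open_nbhd X x U" "path_connected U" "U \<subseteq> U0"
    using assms(2) U0 unfolding locally_path_connected open_nbhd_def by metis
  have "U0 \<subseteq> X"
    using U0 by (rule open_nbhd_subset)
  have loop: "small_equiv X x0 x x (\<lambda>_. x) l" if l: "l \<in> paths_between U0 x x" for l
  proof (rule pi1_small_generated_imp_small_equiv_const[OF assms(1,4)])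
    show "l \<in> loops_at X x"
      using l \<open>U0 \<subseteq> X\<close> by (simp add: loops_at_eq_paths_between paths_between_mono)
    have "induced_map X id (path_class U0 l) = path_class X l"
      using l \<open>U0 \<subseteq> X\<close> by (simp add: induced_map_inclusion loops_at_eq_paths_between)
    moreover have "path_class U0 l \<in> carrier (fundamental_group U0 x)"
      using l by (simp add: fundamental_group_def loops_at_eq_paths_between)
    ultimately show "path_class X l \<in> pi1_small_generated X x"
      using sg by (metis image_subset_iff)
  qed
  have "small_equiv X x0 y z u v"
    if u: "u \<in> paths_between U y z" and v: "v \<in> paths_between U y z" for y z u v
  proof -
    have "x \<in> U"
      using U by (simp add: open_nbhd_def)
    then obtain \<delta> where \<delta>: "\<delta> \<in> paths_between U x y"
      by (rule path_connected_obtains[OF U(2) _ paths_between_endpoints(1)[OF u]])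
    have in_X: "p \<in> paths_between X a b" if "p \<in> paths_between U a b" for p a b
      using that U(3) \<open>U0 \<subseteq> X\<close> by (blast intro: paths_between_mono)
    have "(\<delta> +++ u) +++ reversepath (\<delta> +++ v) \<in> paths_between U x x"
      using \<delta> u v by (intro paths_between_intros)
    then have "small_equiv X x0 x x (\<lambda>_. x) ((\<delta> +++ u) +++ reversepath (\<delta> +++ v))"
      using U(3) by (intro loop) (rule paths_between_mono)
    then have "small_equiv X x0 x z (\<delta> +++ u) (\<delta> +++ v)"
      using in_X[OF \<delta>] in_X[OF u] in_X[OF v]
      by (intro small_equiv_if_small_equiv_join_reversepath[OF join_in_paths_between
            join_in_paths_between])
    then show ?thesis
      using in_X[OF \<delta>] in_X[OF u] in_X[OF v] by (rule small_equiv_cancel_left)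
  qed
  with U(1) show ?thesis by (rule that)
qed

section \<open>Propagation of the equivalence along a loop by bisection\<close>

text \<open>Letting the target neighbourhood \<open>W\<close> at the right end be arbitrary is what makes the
  statement for \<open>[a, b]\<close> and \<open>[b, c]\<close> compose to one for \<open>[a, c]\<close>.\<close>

lemma small_equiv_extend_nbhd:
  assumes loc: "locally path_connected X"
    and nbhd: "\<And>x. x \<in> X \<Longrightarrow> \<exists>U. open_nbhd X x U \<and>
      (\<forall>y z. \<forall>u\<in>paths_between U y z. \<forall>v\<in>paths_between U y z. small_equiv X x0 y z u v)"
    and p: "p \<in> topspace (loop_space X x0)" and "open_nbhd X (p 1) W"
  shows "\<exists>V N. open_nbhd X (p 0) V \<and> openin (loop_space X x0) N \<and> p \<in> N \<and>
    (\<forall>q\<in>N. \<forall>\<delta>\<in>paths_between V (p 0) (q 0). \<exists>\<mu>\<in>paths_between W (p 1) (q 1).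
       small_equiv X x0 (p 0) (q 1) (p +++ \<mu>) (\<delta> +++ q))"
proof -
  \<comment> \<open>A square commuting up to equivalence: the parts of \<open>p\<close> and
    \<open>q\<close> over \<open>[a, b]\<close> are opposite sides, joined by \<delta> in
    \<open>V\<close> over \<open>a\<close> and by \<mu> in \<open>W\<close> over
    \<open>b\<close>.\<close>
  define extends where "extends V W N a b \<longleftrightarrow>
    (\<forall>q\<in>N. \<forall>\<delta>\<in>paths_between V (p a) (q a). \<exists>\<mu>\<in>paths_between W (p b) (q b).
       small_equiv X x0 (p a) (q b) ((p \<circ> linepath a b) +++ \<mu>) (\<delta> +++ (q \<circ> linepath a b)))"
    for V W N and a b :: real
  \<comment> \<open>Bisection tests \<open>P\<close> also on short intervals that stick out of the
    unit interval; the guard makes \<open>P\<close> hold trivially there.\<close>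
  define P where "P a b \<longleftrightarrow> 0 \<le> a \<and> b \<le> 1 \<longrightarrow> (\<forall>W. open_nbhd X (p b) W \<longrightarrow>
    (\<exists>V N. open_nbhd X (p a) V \<and> openin (loop_space X x0) N \<and> p \<in> N \<and> extends V W N a b))"
    for a b :: real
  have loopD: "path q" "path_image q \<subseteq> X" if "q \<in> topspace (loop_space X x0)" for q
    using that by (auto simp: topspace_loop_space loops_at_def)
  have sub: "q \<circ> linepath a b \<in> paths_between X (q a) (q b)"
    if "q \<in> topspace (loop_space X x0)" "0 \<le> a" "a \<le> b" "b \<le> 1" for q and a b :: real
  proof (rule comp_linepath_in_paths_between)
    show "q ` {a..b} \<subseteq> X"
      using loopD(2)[OF that(1)] that(2-) by (force simp: path_image_def)
  qed (use that loopD(1) in auto)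
  have "P 0 1"
    using zero_le_one
  proof (induction rule: Bolzano)
    case (trans a b c)
    show ?case
      unfolding P_def
    proof (intro impI allI)
      fix W assume ac: "0 \<le> a \<and> c \<le> 1" and W: "open_nbhd X (p c) W"
      have "0 \<le> b" "b \<le> 1" using ac \<open>a \<le> b\<close> \<open>b \<le> c\<close> by auto
      \<comment> \<open>The right half comes first: the neighbourhood \<open>V2\<close> it needs at
        \<open>b\<close> becomes the target for the left half.\<close>
      then obtain V2 N2 where 2: "open_nbhd X (p b) V2" "openin (loop_space X x0) N2" "p \<in> N2"
        "extends V2 W N2 b c"
        using \<open>P b c\<close> ac W unfolding P_def by blast
      then obtain V1 N1 where 1: "open_nbhd X (p a) V1" "openin (loop_space X x0) N1" "p \<in> N1"
        "extends V1 V2 N1 a b"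
        using \<open>P a b\<close> ac \<open>b \<le> 1\<close> unfolding P_def by blast
      have "extends V1 W (N1 \<inter> N2) a c"
        unfolding extends_def
      proof (intro ballI)
        fix q \<delta> assume q: "q \<in> N1 \<inter> N2" and \<delta>: "\<delta> \<in> paths_between V1 (p a) (q a)"
        have qtop: "q \<in> topspace (loop_space X x0)"
          using q 1(2) openin_subset by blast
        obtain \<mu> where \<mu>: "\<mu> \<in> paths_between V2 (p b) (q b)"
          and eq1: "small_equiv X x0 (p a) (q b)
            ((p \<circ> linepath a b) +++ \<mu>) (\<delta> +++ (q \<circ> linepath a b))"
          using 1(4) q \<delta> unfolding extends_def by blast
        obtain \<nu> where \<nu>: "\<nu> \<in> paths_between W (p c) (q c)"
          and eq2: "small_equiv X x0 (p b) (q c)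
            ((p \<circ> linepath b c) +++ \<nu>) (\<mu> +++ (q \<circ> linepath b c))"
          using 2(4) q \<mu> unfolding extends_def by blast
        have "V1 \<subseteq> X" "V2 \<subseteq> X" "W \<subseteq> X"
          using 1(1) 2(1) W by (simp_all add: open_nbhd_subset)
        then have X: "\<delta> \<in> paths_between X (p a) (q a)" "\<mu> \<in> paths_between X (p b) (q b)"
          "\<nu> \<in> paths_between X (p c) (q c)"
          using \<delta> \<mu> \<nu> by (auto intro: paths_between_mono)
        have pX: "p \<circ> linepath a b \<in> paths_between X (p a) (p b)"
          "p \<circ> linepath b c \<in> paths_between X (p b) (p c)"
          and qX: "q \<circ> linepath a b \<in> paths_between X (q a) (q b)"
          "q \<circ> linepath b c \<in> paths_between X (q b) (q c)"
          using sub p qtop ac \<open>0 \<le> b\<close> \<open>b \<le> 1\<close> \<open>a \<le> b\<close> \<open>b \<le> c\<close> by auto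
        have pj: "homotopic_paths X ((p \<circ> linepath a b) +++ (p \<circ> linepath b c)) (p \<circ> linepath a c)"
          and qj: "homotopic_paths X ((q \<circ> linepath a b) +++ (q \<circ> linepath b c)) (q \<circ> linepath a c)"
          using loopD[OF p] loopD[OF qtop] ac \<open>a \<le> b\<close> \<open>b \<le> c\<close>
          by (simp_all add: homotopic_paths_join_linepaths)
        \<comment> \<open>The two squares are pasted along their common side \<mu>.\<close>
        have "small_equiv X x0 (p a) (q c) ((p \<circ> linepath a c) +++ \<nu>)
            (((p \<circ> linepath a b) +++ (p \<circ> linepath b c)) +++ \<nu>)"
          using X pX
          by (intro small_equiv_sym[OF small_equiv_homotopic] homotopic_paths_join_right[OF pj]
              join_in_paths_between)
        also have "small_equiv X x0 (p a) (q c) \<dots>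
            ((p \<circ> linepath a b) +++ ((p \<circ> linepath b c) +++ \<nu>))"
          using X pX
          by (intro small_equiv_homotopic homotopic_paths_assoc_between join_in_paths_between)
        also have "small_equiv X x0 (p a) (q c) \<dots>
            ((p \<circ> linepath a b) +++ (\<mu> +++ (q \<circ> linepath b c)))"
          using pX(1) eq2 by (rule small_equiv_join_left)
        also have "small_equiv X x0 (p a) (q c) \<dots>
            (((p \<circ> linepath a b) +++ \<mu>) +++ (q \<circ> linepath b c))"
          using X pX qX by (intro small_equiv_sym[OF small_equiv_homotopic]
              homotopic_paths_assoc_between join_in_paths_between)
        also have "small_equiv X x0 (p a) (q c) \<dots>
            ((\<delta> +++ (q \<circ> linepath a b)) +++ (q \<circ> linepath b c))"
          using eq1 qX(2) by (rule small_equiv_join_right)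
        also have "small_equiv X x0 (p a) (q c) \<dots>
            (\<delta> +++ ((q \<circ> linepath a b) +++ (q \<circ> linepath b c)))"
          using X qX
          by (intro small_equiv_homotopic homotopic_paths_assoc_between join_in_paths_between)
        also have "small_equiv X x0 (p a) (q c) \<dots> (\<delta> +++ (q \<circ> linepath a c))"
          using X qX
          by (intro small_equiv_homotopic homotopic_paths_join_left[OF qj] join_in_paths_between)
        finally show "\<exists>\<nu>\<in>paths_between W (p c) (q c). small_equiv X x0 (p a) (q c)
            ((p \<circ> linepath a c) +++ \<nu>) (\<delta> +++ (q \<circ> linepath a c))"
          using \<nu> by blast
      qed
      then show "\<exists>V N. open_nbhd X (p a) V \<and> openin (loop_space X x0) N \<and> p \<in> N \<and>
          extends V W N a c"
        using 1 2 by blast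
    qed
  next
    case (local x)
    then have "p x \<in> X"
      using loopD(2)[OF p] by (auto simp: path_image_def)
    then obtain U where U: "open_nbhd X (p x) U"
      and equiv: "\<And>y z u v. \<lbrakk>u \<in> paths_between U y z; v \<in> paths_between U y z\<rbrakk> \<Longrightarrow>
        small_equiv X x0 y z u v"
      using nbhd by blast
    have "openin (top_of_set {0..1}) ({0..1} \<inter> p -` U)"
      using loopD[OF p] U
      by (intro continuous_openin_preimage[where T = X])
        (auto simp: path_def path_image_def open_nbhd_def)
    moreover have "x \<in> {0..1} \<inter> p -` U"
      using local U by (simp add: open_nbhd_def)
    ultimately obtain d where d: "d > 0" "ball x d \<inter> {0..1} \<subseteq> {0..1} \<inter> p -` U"
      unfolding openin_contains_ball by blast
    have "P a b" if ab: "a \<le> x" "x \<le> b" "b - a < d" for a b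
      unfolding P_def
    proof (intro impI allI)
      fix W assume ab01: "0 \<le> a \<and> b \<le> 1" and W: "open_nbhd X (p b) W"
      have pU: "p ` {a..b} \<subseteq> U"
      proof (rule image_subsetI)
        fix t assume "t \<in> {a..b}"
        then have "t \<in> ball x d \<inter> {0..1}"
          using ab ab01 by (auto simp: dist_real_def)
        then show "p t \<in> U" using d by blast
      qed
      then have "p a \<in> U" "p b \<in> U"
        using ab by auto
      then have "openin (top_of_set X) (W \<inter> U)" "p b \<in> W \<inter> U"
        using U W by (auto simp: open_nbhd_def)
      then obtain V where V: "openin (top_of_set X) V" "path_connected V" "p b \<in> V" "V \<subseteq> W \<inter> U"
        using loc unfolding locally_path_connected by metis
      \<comment> \<open>The first condition keeps \<open>q\<close> inside \<open>U\<close> over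
        \<open>[a, b]\<close>. The second puts \<open>q b\<close> into the path connected
        \<open>V\<close>, where a path \<mu> from \<open>p b\<close> is available.\<close>
      define N where "N = {q \<in> topspace (loop_space X x0). q ` {a..b} \<subseteq> U} \<inter>
        {q \<in> topspace (loop_space X x0). q ` {b} \<subseteq> V}"
      have "openin (loop_space X x0) N"
        unfolding N_def using ab ab01 U V
        by (intro openin_Int openin_loop_space_subbasis) (auto simp: open_nbhd_def)
      moreover have "p \<in> N"
        using p pU V by (simp add: N_def)
      moreover have "extends U W N a b"
        unfolding extends_def
      proof (intro ballI)
        fix q \<delta> assume q: "q \<in> N" and \<delta>: "\<delta> \<in> paths_between U (p a) (q a)"
        have "q b \<in> V"
          using q by (simp add: N_def)
        then obtain \<mu> where \<mu>: "\<mu> \<in> paths_between V (p b) (q b)"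
          using path_connected_obtains[OF V(2,3)] by blast
        have "p \<circ> linepath a b \<in> paths_between U (p a) (p b)"
          "q \<circ> linepath a b \<in> paths_between U (q a) (q b)"
          using ab ab01 pU q loopD(1)[OF p] loopD(1)[of q]
          by (auto simp: N_def intro!: comp_linepath_in_paths_between)
        moreover have "\<mu> \<in> paths_between U (p b) (q b)" "\<mu> \<in> paths_between W (p b) (q b)"
          using \<mu> V(4) by (auto intro: paths_between_mono)
        \<comment> \<open>Both ways round the square lie in \<open>U\<close> and have the same
          endpoints, so the choice of \<open>U\<close> makes them equivalent.\<close>
        ultimately show "\<exists>\<mu>\<in>paths_between W (p b) (q b). small_equiv X x0 (p a) (q b)
            ((p \<circ> linepath a b) +++ \<mu>) (\<delta> +++ (q \<circ> linepath a b))"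
          using \<delta> by (blast intro: equiv join_in_paths_between)
      qed
      moreover have "open_nbhd X (p a) U"
        using U \<open>p a \<in> U\<close> by (simp add: open_nbhd_def)
      ultimately show "\<exists>V N. open_nbhd X (p a) V \<and> openin (loop_space X x0) N \<and> p \<in> N \<and>
          extends V W N a b"
        by blast
    qed
    with d(1) show ?case by blast
  qed
  then obtain V N where "open_nbhd X (p 0) V" "openin (loop_space X x0) N" "p \<in> N"
    "extends V W N 0 1"
    using assms(4) unfolding P_def by auto
  then show ?thesis
    unfolding extends_def comp_linepath_0_1 by blast
qed

section \<open>From semilocal small generation to openness\<close>

lemma semilocally_small_generated_imp_open_pi1_small:
  assumes "SSLT_at X x0" "locally path_connected X" "semilocally_small_generated X" "x0 \<in> X"
  shows "openin (pi1_qtop X x0) (pi1_small X x0)"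
  unfolding pi1_qtop_def openin_quotient_topology
proof
  have "pi1_small X x0 \<subseteq> topspace (pi1_qtop X x0)"
    using subgroup.subset[OF subgroup_pi1_small[OF assms(4)]] by (simp add: topspace_pi1_qtop)
  also have "\<dots> = path_class X ` topspace (loop_space X x0)"
    unfolding pi1_qtop_def
    by (rule quotient_imp_surjective_map[OF quotient_map_quotient_topology, symmetric])
  finally show "pi1_small X x0 \<subseteq> path_class X ` topspace (loop_space X x0)" .
  have nbhd: "\<exists>U. open_nbhd X x U \<and>
      (\<forall>y z. \<forall>u\<in>paths_between U y z. \<forall>v\<in>paths_between U y z. small_equiv X x0 y z u v)"
    if "x \<in> X" for x
    using small_equiv_nbhd[OF assms(1-3) that] by metis
  let ?c = "\<lambda>_::real. x0"
  have c: "?c \<in> paths_between X x0 x0"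
    using assms(4) by (rule const_in_paths_between)
  let ?H = "{p \<in> topspace (loop_space X x0). path_class X p \<in> pi1_small X x0}"
  show "openin (loop_space X x0) ?H"
    unfolding openin_subopen[of _ ?H]
  proof
    fix p assume "p \<in> ?H"
    then have p: "p \<in> topspace (loop_space X x0)" and small: "small_loop X x0 p"
      by (auto simp: path_class_in_pi1_small_iff)
    note p_const = small_loop_imp_small_equiv_const[OF assms(1) small]
    have ends: "q 0 = x0" "q 1 = x0" if "q \<in> topspace (loop_space X x0)" for q
      using that by (auto simp: topspace_loop_space loops_at_def pathstart_def pathfinish_def)
    \<comment> \<open>\<open>U\<close> is prescribed as the target at the end of \<open>p\<close>,
      so that the final correction \<mu> is a loop in \<open>U\<close> and thus equivalent to the
      constant.\<close>
    obtain U where U: "open_nbhd X x0 U"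
      and equiv: "\<And>y z u v. \<lbrakk>u \<in> paths_between U y z; v \<in> paths_between U y z\<rbrakk> \<Longrightarrow>
        small_equiv X x0 y z u v"
      using nbhd[OF assms(4)] by blast
    then have "open_nbhd X (p 1) U"
      by (simp add: ends[OF p])
    from small_equiv_extend_nbhd[OF assms(2) nbhd p this]
    obtain V N where V: "open_nbhd X x0 V" and N: "openin (loop_space X x0) N" "p \<in> N"
      and ext: "\<And>q \<delta>. \<lbrakk>q \<in> N; \<delta> \<in> paths_between V x0 (q 0)\<rbrakk> \<Longrightarrow>
        \<exists>\<mu>\<in>paths_between U x0 (q 1). small_equiv X x0 x0 (q 1) (p +++ \<mu>) (\<delta> +++ q)"
      unfolding ends[OF p] by blast
    have "N \<subseteq> ?H"
    proof
      fix q assume q: "q \<in> N"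
      then have qtop: "q \<in> topspace (loop_space X x0)"
        using N openin_subset by blast
      then have qX: "q \<in> paths_between X x0 x0"
        by (simp add: topspace_loop_space loops_at_eq_paths_between)
      \<comment> \<open>Every \<open>q\<close> in \<open>N\<close> is based at \<open>x0\<close>, so
        the constant may serve as \<delta>. The square then says that \<open>p +++ \<mu>\<close> is
        equivalent to \<open>q\<close>, and both \<open>p\<close> and \<mu> are equivalent to the
        constant.\<close>
      have "?c \<in> paths_between V x0 x0" and cU: "?c \<in> paths_between U x0 x0"
        using U V by (auto simp: open_nbhd_def intro: const_in_paths_between)
      then obtain \<mu> where \<mu>: "\<mu> \<in> paths_between U x0 x0"
        and eq: "small_equiv X x0 x0 x0 (p +++ \<mu>) (?c +++ q)"
        using ext[OF q, of ?c] ends[OF qtop] by auto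
      note \<mu>_const = equiv[OF cU \<mu>]
      note pX = small_equiv_paths(2)[OF p_const] and \<mu>X = small_equiv_paths(2)[OF \<mu>_const]
      note p_const
      also have "small_equiv X x0 x0 x0 p (p +++ ?c)"
        using pX c
        by (intro small_equiv_sym[OF small_equiv_homotopic] homotopic_paths_join_const
            join_in_paths_between)
      also have "small_equiv X x0 x0 x0 \<dots> (p +++ \<mu>)"
        using pX \<mu>_const by (rule small_equiv_join_left)
      also note eq
      also have "small_equiv X x0 x0 x0 (?c +++ q) q"
        using qX c
        by (intro small_equiv_homotopic homotopic_paths_const_join join_in_paths_between)
      finally have "small_loop X x0 q"
        by (rule small_equiv_const_imp_small_loop)
      then show "q \<in> ?H"
        using qtop by (simp add: path_class_in_pi1_small_iff)
    qed
    with N show "\<exists>T. openin (loop_space X x0) T \<and> p \<in> T \<and> T \<subseteq> ?H" by blast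
  qed
qed

text \<open>Path connectedness provides the path from \<open>x0\<close> to an arbitrary point along
  which the backward implication carries smallness.\<close>

theorem corollary3p7:
  fixes X :: "'a::topological_space set" and x0 :: 'a
  assumes "x0 \<in> X"
    and "path_connected X"
    and "locally path_connected X"
    and "SSLT_at X x0"
  shows "semilocally_small_generated X \<longleftrightarrow>
    subgroup (pi1_small X x0) (fundamental_group X x0) \<and> openin (pi1_qtop X x0) (pi1_small X x0)"
  using assms subgroup_pi1_small semilocally_small_generated_imp_open_pi1_small
    open_pi1_small_imp_semilocally_small_generated by blast

end
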